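(* Let $\alpha_k=(-1)^{\lfloor(4k+1)/3\rfloor}q^{k(2k-1)/3}(1+q+\cdots+q^{2k})$ if $k\not\equiv1\pmod 3$ and $\alpha_k=0$ if $k\equiv1\pmod3$. Then for every integer $p\ge1$, every positive integer $N$ and every primitive $N$th root of unity $q$, $$H_p^{(8)}(q)=-q(1-q)\sum_{k=0}^{N-1}(-1)^kq^{\binom{k+1}{2}+(p-1)(k^2+k)}\alpha_k.$$
   Context: $(a)_n=\prod_{k=1}^n(1-aq^{k-1})$, $\begin{bmatrix} n\\ k\end{bmatrix}=\frac{(q)_n}{(q)_{n-k}(q)_k}$. $H_p^{(8)}(q)=\sum_{n_p\ge\cdots\ge n_1\ge0}q^{-n_p(n_p+2)}(q^{n_p+1})_{n_p+1}\prod_{i=1}^{p-1}q^{n_i(n_i+1)}\begin{bmatrix} n_{i+1}\\ n_i\end{bmatrix}$; at a root of unity only finitely many terms are nonzero. (The factor $1+q+\cdots+q^{2k}$ is $\frac{1-q^{2k+1}}{1-q}$.) *)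

theory Defs
  imports "HOL-Analysis.Analysis"
begin

definition qpoch :: "complex \<Rightarrow> complex \<Rightarrow> nat \<Rightarrow> complex" where
  "qpoch q a n = (\<Prod>k = 1..n. 1 - a * q ^ (k - 1))"

(* At a primitive N-th root of unity the denominator is nonzero whenever n < N.
   For n >= N it may vanish (then x / 0 = 0); in H8 all such terms are zero anyway,
   see below. *)
definition qbinom :: "complex \<Rightarrow> nat \<Rightarrow> nat \<Rightarrow> complex" where
  "qbinom q n k = qpoch q q n / (qpoch q q (n - k) * qpoch q q k)"

(* The sequences n_1 <= ... <= n_p of natural numbers; they are functions made
   extensional outside {1..p}, so that each sequence is counted once. *)
definition index_seqs :: "nat \<Rightarrow> (nat \<Rightarrow> nat) set" where
  "index_seqs p = {n \<in> {1..p} \<rightarrow>\<^sub>E UNIV. mono_on {1..p} n}"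

definition H8_term :: "nat \<Rightarrow> complex \<Rightarrow> (nat \<Rightarrow> nat) \<Rightarrow> complex" where
  "H8_term p q n =
     q powi (- int (n p * (n p + 2))) * qpoch q (q ^ (n p + 1)) (n p + 1) *
     (\<Prod>i = 1..p - 1. q ^ (n i * (n i + 1)) * qbinom q (n (i + 1)) (n i))"

(* At an N-th root of unity (N > 0) the factor (q^(n_p+1))_(n_p+1) is zero as soon as
   n_p + 1 >= N, because one of the exponents n_p + 1, ..., 2 n_p + 1 is then a multiple
   of N. So the infinite sum has only finitely many nonzero terms. *)
definition H8 :: "nat \<Rightarrow> complex \<Rightarrow> complex" where
  "H8 p q = (\<Sum>\<^sub>\<infinity>n\<in>index_seqs p. H8_term p q n)"

(* The divisions are on nat: (4 k + 1) div 3 is the floor, while k (2 k - 1) div 3 is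
   exact in the case k mod 3 \<noteq> 1 (for k = 0 the truncated 2 k - 1 is multiplied by 0). *)
definition alpha :: "complex \<Rightarrow> nat \<Rightarrow> complex" where
  "alpha q k =
     (if k mod 3 = 1 then 0
      else (-1) ^ ((4 * k + 1) div 3) * q ^ (k * (2 * k - 1) div 3) * (\<Sum>j\<le>2 * k. q ^ j))"

definition primitive_root_of_unity :: "nat \<Rightarrow> complex \<Rightarrow> bool" where
  "primitive_root_of_unity N q \<longleftrightarrow> N > 0 \<and> q ^ N = 1 \<and> (\<forall>m. 0 < m \<and> m < N \<longrightarrow> q ^ m \<noteq> 1)"

end

(* The inner sums form a Bailey chain relative to a = q which starts at the unit Bailey pair,
   so (q)_(2n+1) / (q)_n times the sum over n_1, ..., n_(p-1) with n_p = n is an explicit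
   combination of the q-binomials [2n+1; n-r] in which p occurs only through the factor
   q^(p(r^2+r)). Exchanging the sums leaves
     G_r = sum of q^(-n(n+2)) [2n+1; n-r] over n >= r with 2n+1 < N.
   By q-Gosper summation, G_r = q^(2r+4) G_(r+3), because the boundary term at n = N div 2
   contains the factor 1 - q^N = 0. Three initial values at the top of the range then
   determine G_r. On the right-hand side the terms k = r and k = N-1-r combine, since
   (-1)^k q^((k+1 choose 2) + (p-1)(k^2+k)) is invariant under k -> N-1-k, and the combined
   coefficients satisfy the same recurrence with the same initial values. *)

theory Submission
  imports Defs
begin

section \<open>The Bailey chain\<close>

lemma qpoch_0 [simp]: "qpoch q a 0 = 1"
  by (simp add: qpoch_def)

lemma qpoch_Suc: "qpoch q q (Suc n) = qpoch q q n * (1 - q ^ Suc n)"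
  by (simp add: qpoch_def)

lemma qpoch_eq_0_iff: "qpoch q q n = 0 \<longleftrightarrow> (\<exists>k. 0 < k \<and> k \<le> n \<and> q ^ k = 1)"
proof -
  have "qpoch q q n = 0 \<longleftrightarrow> (\<exists>k\<in>{1..n}. q * q ^ (k - 1) = 1)"
    by (auto simp: qpoch_def)
  also have "\<dots> \<longleftrightarrow> (\<exists>k\<in>{1..n}. q ^ k = 1)"
    by (intro bex_cong refl) (auto simp flip: power_Suc)
  finally show ?thesis
    by (auto simp: Suc_le_eq)
qed

text \<open>The identities of this section assume nonvanishing at the largest index that occurs, so
  that they apply to roots of unity of larger order; this passes the assumption down to all other
  denominators.\<close>

lemma qpoch_nonzero_mono:
  assumes "qpoch q q n \<noteq> 0" "m \<le> n"
  shows "qpoch q q m \<noteq> 0"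
  using assms unfolding qpoch_eq_0_iff by (meson order_trans)

text \<open>With m = n+1 and (q)_n nonzero, this turns the factor (q^(n+1))_(n+1) of
  \<open>H8_term\<close> into (q)_(2n+1) / (q)_n.\<close>

lemma qpoch_shift: "qpoch q q n * qpoch q (q ^ (n + 1)) m = qpoch q q (n + m)"
proof (induction m)
  case (Suc m)
  have "qpoch q (q ^ (n + 1)) (Suc m) = qpoch q (q ^ (n + 1)) m * (1 - q ^ Suc (n + m))"
    by (simp add: qpoch_def power_add mult_ac)
  then show ?case
    using Suc.IH by (simp add: qpoch_Suc mult.assoc [symmetric])
qed simp

lemma qbinom_0 [simp]: "qpoch q q n \<noteq> 0 \<Longrightarrow> qbinom q n 0 = 1"
  and qbinom_self [simp]: "qpoch q q n \<noteq> 0 \<Longrightarrow> qbinom q n n = 1"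
  by (simp_all add: qbinom_def)

text \<open>A q-Pascal rule, from 1 - q^(m+1) = (1 - q^(m-j)) + q^(m-j) (1 - q^(j+1)). The case j =
  m is left out: there truncated subtraction gives \<open>qbinom q m (Suc m)\<close> the value 1 /
  (1 - q^(m+1)) and not 0.\<close>

lemma qbinom_Suc_Suc:
  assumes "qpoch q q (Suc m) \<noteq> 0" "j < m"
  shows "qbinom q (Suc m) (Suc j) = qbinom q m (Suc j) + q ^ (m - j) * qbinom q m j"
proof -
  obtain i where i: "m = Suc (i + j)"
    using assms(2) less_iff_Suc_add by (auto simp: add.commute)
  have nz: "qpoch q q l \<noteq> 0" if "l \<le> Suc m" for l
    using assms(1) that by (rule qpoch_nonzero_mono)
  have 1: "1 - q ^ Suc l \<noteq> 0" if "l \<le> m" for l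
    using nz[of "Suc l"] that by (simp add: qpoch_Suc)
  have 2: "qpoch q q (Suc m) = qpoch q q m * ((1 - q ^ Suc i) + q ^ Suc i * (1 - q ^ Suc j))"
    unfolding qpoch_Suc[of q m] unfolding i by (simp add: algebra_simps power_add)
  have 3: "qbinom q m (Suc j) =
      qpoch q q m * (1 - q ^ Suc i) / (qpoch q q (Suc i) * qpoch q q (Suc j))"
    using 1[of i] by (simp add: qbinom_def i qpoch_Suc[of q i] del: power_Suc)
  have 4: "qbinom q m j =
      qpoch q q m * (1 - q ^ Suc j) / (qpoch q q (Suc i) * qpoch q q (Suc j))"
    using 1[of j] by (simp add: qbinom_def i qpoch_Suc[of q j] Suc_diff_le del: power_Suc)
  have 5: "qbinom q (Suc m) (Suc j) =
      qpoch q q (Suc m) / (qpoch q q (Suc i) * qpoch q q (Suc j))"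
    by (simp add: qbinom_def i)
  have 6: "m - j = Suc i"
    by (simp add: i)
  show ?thesis
    unfolding 3 4 5 6 2 by (simp add: add_divide_distrib distrib_left mult_ac del: power_Suc)
qed

text \<open>The q-Pascal rule summed against arbitrary weights, in the form of the induction step of
  \<open>q_Vandermonde\<close>. The end terms, which the rule does not cover, have q-binomial
  1.\<close>

lemma sum_qbinom_Suc:
  assumes "qpoch q q (Suc m) \<noteq> 0"
  shows "(\<Sum>j\<le>Suc m. qbinom q (Suc m) j * x j) =
    (\<Sum>j\<le>m. qbinom q m j * x j) + (\<Sum>j\<le>m. q ^ (m - j) * qbinom q m j * x (Suc j))"
proof -
  have m: "qpoch q q m \<noteq> 0"
    using assms by (rule qpoch_nonzero_mono) simp
  have "(\<Sum>j\<le>Suc m. qbinom q (Suc m) j * x j) =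
      x 0 + ((\<Sum>j<m. qbinom q (Suc m) (Suc j) * x (Suc j)) + x (Suc m))"
    using assms
    by (subst sum.atMost_Suc_shift) (simp add: lessThan_Suc_atMost [symmetric])
  also have "(\<Sum>j<m. qbinom q (Suc m) (Suc j) * x (Suc j)) =
      (\<Sum>j<m. qbinom q m (Suc j) * x (Suc j)) + (\<Sum>j<m. q ^ (m - j) * qbinom q m j * x (Suc j))"
    using assms by (simp add: qbinom_Suc_Suc sum.distrib algebra_simps)
  also have "x 0 + (\<dots> + x (Suc m)) =
      (\<Sum>j<Suc m. qbinom q m j * x j) +
      (\<Sum>j<Suc m. q ^ (m - j) * qbinom q m j * x (Suc j))"
    using m by (subst sum.lessThan_Suc_shift) simp
  finally show ?thesis
    by (simp only: lessThan_Suc_atMost)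
qed

text \<open>A limiting case of the q-Vandermonde sum. The q-Pascal rule reduces (m+1, s) to (m, s)
  and (m, s+1), hence the induction for arbitrary s.\<close>

lemma q_Vandermonde:
  assumes "qpoch q q (m + s) \<noteq> 0"
  shows "(\<Sum>j\<le>m. qbinom q m j * (q ^ (j * (j + s)) / qpoch q q (j + s))) = 1 / qpoch q q (m + s)"
  using assms
proof (induction m arbitrary: s)
  case (Suc m)
  have nz: "qpoch q q l \<noteq> 0" if "l \<le> Suc m + s" for l
    using Suc.prems that by (rule qpoch_nonzero_mono)
  \<comment> \<open>Since (m-j) + (j+1)(j+1+s) = (m+s+1) + j(j+s+1), the shifted sum is the sum for
    s+1 up to a factor free of j.\<close>
  have "(\<Sum>j\<le>m. q ^ (m - j) * qbinom q m j * (q ^ (Suc j * (Suc j + s)) / qpoch q q (Suc j + s)))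
      = q ^ (m + Suc s) * (\<Sum>j\<le>m. qbinom q m j * (q ^ (j * (j + Suc s)) / qpoch q q (j + Suc s)))"
    unfolding sum_distrib_left
  proof (rule sum.cong [OF refl])
    fix j assume "j \<in> {..m}"
    then obtain i where "m = j + i"
      using le_Suc_ex by auto
    then have "q ^ (m - j) * q ^ (Suc j * (Suc j + s)) = q ^ (m + Suc s) * q ^ (j * (j + Suc s))"
      by (simp add: power_add [symmetric] algebra_simps)
    then have "q ^ (m - j) * q ^ (Suc j * (Suc j + s)) * (qbinom q m j / qpoch q q (Suc j + s)) =
        q ^ (m + Suc s) * q ^ (j * (j + Suc s)) * (qbinom q m j / qpoch q q (j + Suc s))"
      by (simp only: add_Suc_right add_Suc)
    then show "q ^ (m - j) * qbinom q m j * (q ^ (Suc j * (Suc j + s)) / qpoch q q (Suc j + s)) =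
        q ^ (m + Suc s) * (qbinom q m j * (q ^ (j * (j + Suc s)) / qpoch q q (j + Suc s)))"
      by (simp only: times_divide_eq_right mult_ac)
  qed
  also have "\<dots> = q ^ (m + Suc s) / qpoch q q (m + Suc s)"
    using Suc.IH[of "Suc s"] nz by simp
  finally have "(\<Sum>j\<le>Suc m. qbinom q (Suc m) j * (q ^ (j * (j + s)) / qpoch q q (j + s))) =
      1 / qpoch q q (m + s) + q ^ (m + Suc s) / qpoch q q (m + Suc s)"
    unfolding sum_qbinom_Suc[OF nz[OF le_add1]] using Suc.IH[of s] nz[of "m + s"]
    by simp
  also have "\<dots> = 1 / qpoch q q (Suc m + s)"
    using nz[of "Suc (m + s)"] by (simp add: qpoch_Suc field_simps)
  finally show ?case .
qed simp

text \<open>Starting the chain at a delta function instead of the constant 1 makes the unit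
  Bailey pair the base case.\<close>

primrec chain_sum :: "complex \<Rightarrow> nat \<Rightarrow> nat \<Rightarrow> complex" where
  "chain_sum q 0 n = of_bool (n = 0)"
| "chain_sum q (Suc p) n = (\<Sum>k\<le>n. q ^ (k * (k + 1)) * qbinom q n k * chain_sum q p k)"

text \<open>This is 1 - q times the usual alpha_r of the unit Bailey pair relative to a = q; the
  extra factor turns the denominator (q^2)_(n+r) into (q)_(n+r+1).\<close>

definition unit_coeff :: "complex \<Rightarrow> nat \<Rightarrow> complex" where
  "unit_coeff q r = (-1) ^ r * q ^ (r choose 2) * (1 - q ^ (2 * r + 1))"

lemma unit_Bailey_pair:
  assumes "qpoch q q (2 * n + 1) \<noteq> 0"
  shows "(\<Sum>r\<le>n. unit_coeff q r / (qpoch q q (n - r) * qpoch q q (n + r + 1))) = of_bool (n = 0)"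
proof (cases "n = 0")
  case True
  then show ?thesis
    using assms by (simp add: unit_coeff_def qpoch_def binomial_eq_0)
next
  case False
  have nz: "qpoch q q l \<noteq> 0" if "l \<le> 2 * n + 1" for l
    using assms that by (rule qpoch_nonzero_mono)
  have nz1: "1 - q ^ Suc l \<noteq> 0" if "l \<le> 2 * n" for l
    using nz[of "Suc l"] that by (simp add: qpoch_Suc)
  \<comment> \<open>The summands, multiplied by \<^term>\<open>1 - q ^ n\<close>, are the differences of \<open>h\<close>.\<close>
  define h where "h r = (if r \<le> n then (-1) ^ r * q ^ (r choose 2) * (1 - q ^ r) /
    (qpoch q q (n - r) * qpoch q q (n + r)) else 0)" for r
  have "(1 - q ^ n) * (unit_coeff q r / (qpoch q q (n - r) * qpoch q q (n + r + 1))) = h r - h (Suc r)"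
    if "r \<le> n" for r
  proof -
    obtain i where i: "n = r + i"
      using \<open>r \<le> n\<close> le_Suc_ex by auto
    let ?c = "(-1) ^ r * q ^ (r choose 2) / (qpoch q q (n - r) * qpoch q q (n + r + 1))"
    have "h r = ?c * (1 - q ^ r) * (1 - q ^ Suc (n + r))"
      using that nz1[of "n + r"] by (simp add: h_def qpoch_Suc del: power_Suc)
    moreover have "h (Suc r) = - ?c * q ^ r * (1 - q ^ Suc r) * (1 - q ^ (n - r))"
    proof (cases i)
      case 0
      then show ?thesis using i by (simp add: h_def)
    next
      case (Suc l)
      have "Suc r choose 2 = (r choose 2) + r"
        by (simp add: numeral_2_eq_2)
      then have *: "h (Suc r) = (-1) ^ Suc r * q ^ ((r choose 2) + r) * (1 - q ^ Suc r) /
          (qpoch q q l * qpoch q q (n + r + 1))"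
        by (simp only: h_def) (simp add: i Suc)
      have "qpoch q q (n - r) = qpoch q q l * (1 - q ^ Suc l)" "n - r = Suc l"
        by (simp_all add: i Suc qpoch_Suc)
      moreover have "1 - q ^ Suc l \<noteq> 0"
        by (rule nz1) (simp add: i Suc)
      ultimately show ?thesis
        unfolding * by (simp add: power_add mult_ac power_Suc[of "- 1"] del: power_Suc)
    qed
    moreover have "(1 - q ^ r) * (1 - q ^ Suc (n + r)) + q ^ r * (1 - q ^ Suc r) * (1 - q ^ (n - r)) =
        (1 - q ^ n) * (1 - q ^ (2 * r + 1))"
      by (simp add: i algebra_simps power_add mult_2 mult_2_right)
    ultimately have "h r - h (Suc r) = ?c * ((1 - q ^ n) * (1 - q ^ (2 * r + 1)))"
      by (smt (verit) diff_minus_eq_add distrib_left mult.assoc mult_minus_left)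
    then show ?thesis
      by (simp add: unit_coeff_def mult_ac)
  qed
  then have "(1 - q ^ n) * (\<Sum>r\<le>n. unit_coeff q r / (qpoch q q (n - r) * qpoch q q (n + r + 1))) =
      (\<Sum>r\<le>n. h r - h (Suc r))"
    by (simp add: sum_distrib_left)
  \<comment> \<open>\<open>h 0\<close> vanishes through its factor 1 - q^0, and
    \<open>h (Suc n)\<close> by the default value. As n > 0, the factor 1 - q^n can then be
    cancelled.\<close>
  also have "\<dots> = 0"
    unfolding sum_telescope by (simp add: h_def)
  finally show ?thesis
    using False nz1[of "n - 1"] by simp
qed

text \<open>The Bailey lemma with both parameters sent to infinity, iterated p times: the left side
  is beta_n, and each iteration multiplies alpha_r by a^r q^(r^2) = q^(r^2+r).\<close>

lemma chain_sum_Bailey: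
  assumes "qpoch q q (2 * n + 1) \<noteq> 0"
  shows "chain_sum q p n / qpoch q q n =
    (\<Sum>r\<le>n. q ^ (p * (r ^ 2 + r)) * unit_coeff q r / (qpoch q q (n - r) * qpoch q q (n + r + 1)))"
  using assms
proof (induction p arbitrary: n)
  case 0
  then show ?case
    using unit_Bailey_pair[of q n] by simp
next
  case (Suc p)
  have nz: "qpoch q q l \<noteq> 0" if "l \<le> 2 * n + 1" for l
    using Suc.prems that by (rule qpoch_nonzero_mono)
  \<comment> \<open>What the Bailey lemma needs after the sums over k and r are exchanged: the shift
    k = j + r makes it \<open>q_Vandermonde\<close> with s = 2r+1.\<close>
  have inner: "(\<Sum>k=r..n. q ^ (k * (k + 1)) / (qpoch q q (n - k) * (qpoch q q (k - r) * qpoch q q (k + r + 1)))) =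
      q ^ (r ^ 2 + r) / (qpoch q q (n - r) * qpoch q q (n + r + 1))" if "r \<le> n" for r
  proof -
    obtain m where m: "n = r + m"
      using \<open>r \<le> n\<close> le_Suc_ex by auto
    have "(\<Sum>k=r..n. q ^ (k * (k + 1)) / (qpoch q q (n - k) * (qpoch q q (k - r) * qpoch q q (k + r + 1)))) =
        (\<Sum>j\<le>m. q ^ ((j + r) * (j + r + 1)) / (qpoch q q (m - j) * (qpoch q q j * qpoch q q (j + (2 * r + 1)))))"
      unfolding m atMost_atLeast0
      by (rule sum.reindex_bij_witness [of _ "\<lambda>j. j + r" "\<lambda>k. k - r"]) (auto simp: algebra_simps mult_2)
    also have "\<dots> = q ^ (r ^ 2 + r) / qpoch q q m *
        (\<Sum>j\<le>m. qbinom q m j * (q ^ (j * (j + (2 * r + 1))) / qpoch q q (j + (2 * r + 1))))"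
      unfolding sum_distrib_left
    proof (rule sum.cong [OF refl])
      fix j assume "j \<in> {..m}"
      have "q ^ ((j + r) * (j + r + 1)) = q ^ (r ^ 2 + r) * q ^ (j * (j + (2 * r + 1)))"
        by (simp add: power_add [symmetric] algebra_simps power2_eq_square mult_2_right)
      then show "q ^ ((j + r) * (j + r + 1)) / (qpoch q q (m - j) * (qpoch q q j * qpoch q q (j + (2 * r + 1)))) =
          q ^ (r ^ 2 + r) / qpoch q q m *
          (qbinom q m j * (q ^ (j * (j + (2 * r + 1))) / qpoch q q (j + (2 * r + 1))))"
        using nz[of m] m by (simp add: qbinom_def)
    qed
    also have "\<dots> = q ^ (r ^ 2 + r) / (qpoch q q (n - r) * qpoch q q (n + r + 1))"
      using q_Vandermonde[of q m "2 * r + 1"] nz[of "n + r + 1"] m by (simp add: mult_2 add_ac)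
    finally show ?thesis .
  qed
  have "chain_sum q (Suc p) n / qpoch q q n =
      (\<Sum>k\<le>n. q ^ (k * (k + 1)) / qpoch q q (n - k) * (chain_sum q p k / qpoch q q k))"
    using nz[of n] by (simp add: qbinom_def sum_divide_distrib mult_ac)
  also have "\<dots> = (\<Sum>k\<le>n. \<Sum>r\<le>k. q ^ (k * (k + 1)) / qpoch q q (n - k) *
      (q ^ (p * (r ^ 2 + r)) * unit_coeff q r / (qpoch q q (k - r) * qpoch q q (k + r + 1))))"
    using Suc.IH nz by (simp add: sum_distrib_left)
  also have "\<dots> = (\<Sum>r\<le>n. \<Sum>k=r..n. q ^ (k * (k + 1)) / qpoch q q (n - k) *
      (q ^ (p * (r ^ 2 + r)) * unit_coeff q r / (qpoch q q (k - r) * qpoch q q (k + r + 1))))"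
    unfolding sum.Sigma [OF finite_atMost, OF ballI [OF finite_atMost]]
      sum.Sigma [OF finite_atMost, OF ballI [OF finite_atLeastAtMost]]
    by (rule sum.reindex_bij_witness [of _ "\<lambda>(r, k). (k, r)" "\<lambda>(k, r). (r, k)"]) auto
  also have "\<dots> = (\<Sum>r\<le>n. q ^ (p * (r ^ 2 + r)) * unit_coeff q r *
      (\<Sum>k=r..n. q ^ (k * (k + 1)) / (qpoch q q (n - k) * (qpoch q q (k - r) * qpoch q q (k + r + 1)))))"
    by (simp add: sum_distrib_left mult_ac)
  also have "\<dots> = (\<Sum>r\<le>n. q ^ (Suc p * (r ^ 2 + r)) * unit_coeff q r /
      (qpoch q q (n - r) * qpoch q q (n + r + 1)))"
  proof (rule sum.cong [OF refl])
    fix r assume "r \<in> {..n}"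
    then have "r \<le> n"
      by simp
    show "q ^ (p * (r ^ 2 + r)) * unit_coeff q r *
        (\<Sum>k=r..n. q ^ (k * (k + 1)) / (qpoch q q (n - k) * (qpoch q q (k - r) * qpoch q q (k + r + 1)))) =
      q ^ (Suc p * (r ^ 2 + r)) * unit_coeff q r / (qpoch q q (n - r) * qpoch q q (n + r + 1))"
      unfolding inner[OF \<open>r \<le> n\<close>] by (simp add: power_add mult_ac)
  qed
  finally show ?case .
qed

section \<open>Sums over index sequences\<close>

definition index_seqs_to :: "nat \<Rightarrow> nat \<Rightarrow> (nat \<Rightarrow> nat) set" where
  "index_seqs_to p n = {f \<in> index_seqs p. f p = n}"

lemma index_seqs_to_1: "index_seqs_to 1 n = {\<lambda>i\<in>{1}. n}"
proof -
  have "f = (\<lambda>i\<in>{1}. f 1)" if "f \<in> {1..1} \<rightarrow>\<^sub>E UNIV" for f :: "nat \<Rightarrow> nat"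
    using that by (auto simp: fun_eq_iff PiE_def extensional_def)
  then show ?thesis
    by (auto simp: index_seqs_to_def index_seqs_def mono_on_def split: if_splits)
qed

lemma index_seqs_to_Suc:
  assumes "p \<ge> 1"
  shows "index_seqs_to (Suc p) n = (\<Union>k\<le>n. (\<lambda>f. f(Suc p := n)) ` index_seqs_to p k)"
proof (intro equalityI subsetI)
  fix f assume f: "f \<in> index_seqs_to (Suc p) n"
  \<comment> \<open>Dropping the last entry means resetting it to \<open>undefined\<close>, because
    the sequences are extensional functions.\<close>
  have "f(Suc p := undefined) \<in> index_seqs_to p (f p)"
    using f assms by (auto simp: index_seqs_to_def index_seqs_def mono_on_def PiE_def extensional_def)
  moreover have "f p \<le> n"
    using f assms by (auto simp: index_seqs_to_def index_seqs_def mono_on_def)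
  moreover have "f = (f(Suc p := undefined))(Suc p := n)"
    using f by (auto simp: index_seqs_to_def)
  ultimately show "f \<in> (\<Union>k\<le>n. (\<lambda>f. f(Suc p := n)) ` index_seqs_to p k)"
    by blast
next
  fix f assume "f \<in> (\<Union>k\<le>n. (\<lambda>f. f(Suc p := n)) ` index_seqs_to p k)"
  then obtain g k where g: "k \<le> n" "g \<in> index_seqs_to p k" "f = g(Suc p := n)"
    by blast
  have "g i \<le> n" if "i \<in> {1..p}" for i
  proof -
    have "g i \<le> g p"
      using g(2) that by (auto simp: index_seqs_to_def index_seqs_def mono_on_def)
    then show ?thesis
      using g by (simp add: index_seqs_to_def)
  qed
  then show "f \<in> index_seqs_to (Suc p) n"
    using g by (auto simp: index_seqs_to_def index_seqs_def mono_on_def PiE_def extensional_def le_Suc_eq)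
qed

text \<open>All members take the value \<open>undefined\<close> at \<open>Suc p\<close>, so
  overwriting it loses no information.\<close>

lemma inj_on_update_index_seqs_to: "inj_on (\<lambda>f. f(Suc p := n)) (index_seqs_to p k)"
proof (rule inj_onI)
  fix f g assume fg: "f \<in> index_seqs_to p k" "g \<in> index_seqs_to p k" "f(Suc p := n) = g(Suc p := n)"
  have "f (Suc p) = g (Suc p)"
    using fg(1,2) by (simp add: index_seqs_to_def index_seqs_def PiE_def extensional_def)
  then show "f = g"
    using fg(3) by (metis fun_upd_idem fun_upd_upd)
qed

lemma finite_index_seqs_to: "p \<ge> 1 \<Longrightarrow> finite (index_seqs_to p n)"
proof (induction p arbitrary: n rule: nat_induct_at_least)
  case base
  then show ?case by (simp only: index_seqs_to_1) simp
next
  case (Suc p)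
  then show ?case by (simp add: index_seqs_to_Suc)
qed

text \<open>Summing over the last entry but one is the recursion of \<open>chain_sum\<close>. For p
  = 1 the product is empty, and the delta at the start of the chain leaves the single term
  \<open>qbinom q n 0 = 1\<close>.\<close>

lemma sum_index_seqs_to:
  assumes "p \<ge> 1" "qpoch q q n \<noteq> 0"
  shows "(\<Sum>f\<in>index_seqs_to p n. \<Prod>i = 1..p - 1. q ^ (f i * (f i + 1)) * qbinom q (f (i + 1)) (f i)) =
    chain_sum q p n"
  using assms
proof (induction p arbitrary: n rule: nat_induct_at_least)
  case base
  have "(\<Sum>k\<le>n. q ^ (k * (k + 1)) * qbinom q n k * of_bool (k = 0)) =
      (\<Sum>k\<in>{0}. q ^ (k * (k + 1)) * qbinom q n k * of_bool (k = 0))"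
    by (rule sum.mono_neutral_right) auto
  then show ?case
    using base by (simp only: index_seqs_to_1) simp
next
  case (Suc p)
  let ?t = "\<lambda>(f::nat\<Rightarrow>nat) i. q ^ (f i * (f i + 1)) * qbinom q (f (i + 1)) (f i)"
  have step: "(\<Prod>i = 1..p. ?t (f(Suc p := n)) i) =
      q ^ (k * (k + 1)) * qbinom q n k * (\<Prod>i = 1..p - 1. ?t f i)"
    if "f \<in> index_seqs_to p k" for f k
  proof -
    obtain p' where p': "p = Suc p'"
      using Suc.hyps by (cases p) auto
    have "(\<Prod>i = 1..p'. ?t (f(Suc p := n)) i) = (\<Prod>i = 1..p'. ?t f i)"
      by (rule prod.cong) (auto simp: p')
    moreover have "f p = k"
      using that by (simp add: index_seqs_to_def)
    ultimately show ?thesis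
      by (simp add: p')
  qed
  have disj: "(\<lambda>f. f(Suc p := n)) ` index_seqs_to p k \<inter> (\<lambda>f. f(Suc p := n)) ` index_seqs_to p l = {}"
    if "k \<noteq> l" for k l
  proof -
    have "f(Suc p := n) \<noteq> g(Suc p := n)" if "f \<in> index_seqs_to p k" "g \<in> index_seqs_to p l" for f g
      using that \<open>k \<noteq> l\<close> by (auto simp: index_seqs_to_def fun_eq_iff intro!: exI[of _ p])
    then show ?thesis
      by auto
  qed
  have "(\<Sum>f\<in>index_seqs_to (Suc p) n. \<Prod>i = 1..p. ?t f i) =
      (\<Sum>k\<le>n. \<Sum>f\<in>index_seqs_to p k. \<Prod>i = 1..p. ?t (f(Suc p := n)) i)"
    unfolding index_seqs_to_Suc[OF Suc.hyps]
    by (subst sum.UNION_disjoint)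
      (auto simp: finite_index_seqs_to[OF Suc.hyps] disj sum.reindex inj_on_update_index_seqs_to)
  also have "\<dots> = (\<Sum>k\<le>n. q ^ (k * (k + 1)) * qbinom q n k *
      (\<Sum>f\<in>index_seqs_to p k. \<Prod>i = 1..p - 1. ?t f i))"
    unfolding sum_distrib_left by (intro sum.cong refl step)
  also have "\<dots> = chain_sum q (Suc p) n"
    using Suc.IH Suc.prems by (simp add: qpoch_nonzero_mono)
  finally show ?case by simp
qed

text \<open>Cutting the sum at \<open>N div 2\<close> keeps 2n+1 < N for the remaining n, so that
  all denominators of the Bailey expansion are nonzero.\<close>

lemma qpoch_power_root_eq_0:
  assumes "N > 0" "q ^ N = 1" "n \<ge> N div 2"
  shows "qpoch q (q ^ (n + 1)) (n + 1) = 0"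
proof -
  \<comment> \<open>The largest multiple of N up to 2n+1. It is at least N, hence exceeds the
    remainder 2n+1-k, and so lies in the upper half n+1, ..., 2n+1.\<close>
  define k where "k = N * ((2 * n + 1) div N)"
  have "k \<le> 2 * n + 1"
    by (simp add: k_def)
  moreover have "2 * n + 1 \<ge> N"
    using assms(3) by linarith
  moreover have "k + (2 * n + 1) mod N = 2 * n + 1" "(2 * n + 1) mod N < N"
    using assms(1) by (simp_all add: k_def)
  moreover have "N * 1 \<le> k"
    unfolding k_def using \<open>2 * n + 1 \<ge> N\<close> assms(1)
    by (intro mult_le_mono2) (simp only: Suc_le_eq One_nat_def div_greater_zero_iff)
  ultimately have k: "n + 1 \<le> k" "k \<le> 2 * n + 1"
    by linarith+
  have "q ^ (n + 1) * q ^ (k - n - 1) = q ^ k"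
    using k by (simp only: power_add [symmetric]) simp
  also have "\<dots> = 1"
    by (simp add: k_def power_mult assms(2))
  finally have "1 - q ^ (n + 1) * q ^ (k - n - 1) = 0"
    by simp
  then show ?thesis
    unfolding qpoch_def using k by (intro prod_zero bexI[of _ "k - n"]) auto
qed

lemma H8_eq_sum_chain_sum:
  assumes "p \<ge> 1" "primitive_root_of_unity N q"
  shows "H8 p q = (\<Sum>n<N div 2. q powi (- int (n * (n + 2))) *
    (qpoch q q (2 * n + 1) * (chain_sum q p n / qpoch q q n)))"
proof -
  have N: "N > 0" "q ^ N = 1"
    using assms(2) by (auto simp: primitive_root_of_unity_def)
  have nz: "qpoch q q l \<noteq> 0" if "l < N" for l
    using assms(2) that by (auto simp: qpoch_eq_0_iff primitive_root_of_unity_def)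
  have "H8 p q = infsum (H8_term p q) (\<Union>n<N div 2. index_seqs_to p n)"
    unfolding H8_def
  proof (rule infsum_cong_neutral)
    fix f assume "f \<in> index_seqs p - (\<Union>n<N div 2. index_seqs_to p n)"
    then have "f p \<ge> N div 2"
      by (auto simp: index_seqs_to_def)
    then have "qpoch q (q ^ (f p + 1)) (f p + 1) = 0"
      by (rule qpoch_power_root_eq_0[OF N])
    then show "H8_term p q f = 0"
      by (simp only: H8_term_def) simp
  qed (auto simp: index_seqs_to_def)
  also have "\<dots> = (\<Sum>f\<in>(\<Union>n<N div 2. index_seqs_to p n). H8_term p q f)"
    using assms(1) by (intro infsum_finite) (simp add: finite_index_seqs_to)
  also have "\<dots> = (\<Sum>n<N div 2. \<Sum>f\<in>index_seqs_to p n. H8_term p q f)"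
    using assms(1)
    by (intro sum.UNION_disjoint) (auto simp: finite_index_seqs_to, auto simp: index_seqs_to_def)
  also have "\<dots> = (\<Sum>n<N div 2. q powi (- int (n * (n + 2))) *
    (qpoch q q (2 * n + 1) * (chain_sum q p n / qpoch q q n)))"
  proof (rule sum.cong [OF refl])
    fix n assume "n \<in> {..<N div 2}"
    then have n: "n < N"
      by auto
    have "(\<Sum>f\<in>index_seqs_to p n. H8_term p q f) =
        (\<Sum>f\<in>index_seqs_to p n. q powi (- int (n * (n + 2))) * qpoch q (q ^ (n + 1)) (n + 1) *
          (\<Prod>i = 1..p - 1. q ^ (f i * (f i + 1)) * qbinom q (f (i + 1)) (f i)))"
      by (rule sum.cong) (auto simp: H8_term_def index_seqs_to_def)
    also have "\<dots> = q powi (- int (n * (n + 2))) * qpoch q (q ^ (n + 1)) (n + 1) * chain_sum q p n"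
      using sum_index_seqs_to[OF assms(1) nz[OF n]] by (simp only: sum_distrib_left [symmetric])
    also have "qpoch q (q ^ (n + 1)) (n + 1) = qpoch q q (2 * n + 1) / qpoch q q n"
      using qpoch_shift[of q n "n + 1"] nz[OF n] by (simp add: field_simps mult_2 mult_2_right)
    finally show "(\<Sum>f\<in>index_seqs_to p n. H8_term p q f) = q powi (- int (n * (n + 2))) *
        (qpoch q q (2 * n + 1) * (chain_sum q p n / qpoch q q n))"
      by simp
  qed
  finally show ?thesis .
qed

section \<open>Telescoping sums of q-binomials\<close>

text \<open>For M = \<open>N div 2\<close> this is G_r; the quotient is the q-binomial [2n+1; n-r]
  written out.\<close>

definition qsum :: "complex \<Rightarrow> nat \<Rightarrow> nat \<Rightarrow> complex" where
  "qsum q M r = (\<Sum>n=r..<M. q powi (- int (n * (n + 2))) *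
    (qpoch q q (2 * n + 1) / (qpoch q q (n - r) * qpoch q q (n + r + 1))))"

text \<open>The certificate equation of \<open>qsum_term_telescoping\<close> after division by the
  common factor \<open>c\<close>, with u = q, X = q^(n-r) and Y = q^r.\<close>

lemma qsum_telescoping_identity:
  fixes u X Y :: "'a :: field"
  assumes "u \<noteq> 0" "Y \<noteq> 0"
  shows "(1 - X) * (1 - X / u) * (1 - X / u ^ 2) -
      (1 - X * Y ^ 2 * u ^ 2) * (1 - X * Y ^ 2 * u ^ 3) * (1 - X * Y ^ 2 * u ^ 4) / (Y ^ 2 * u ^ 4) =
    (u - 1 / (Y ^ 2 * u ^ 3)) * ((1 - X ^ 2 * Y ^ 2 * u ^ 2) * (1 - X ^ 2 * Y ^ 2 * u ^ 3) / u -
      X ^ 2 * Y ^ 2 * (1 - X) * (1 - X * Y ^ 2 * u ^ 4))"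
  using assms by (simp add: divide_simps) algebra

text \<open>The certificate \<open>g\<close> comes from the \<open>q\<close>-Gosper algorithm; it vanishes at both ends
  of the range of summation, at the upper one because of \<^term>\<open>q ^ N = 1\<close>.\<close>

lemma qsum_term_telescoping:
  assumes "qpoch q q (2 * r + i + 4) \<noteq> 0" "q \<noteq> 0"
  defines "n \<equiv> r + i"
  defines "t \<equiv> \<lambda>r n. if r \<le> n then q powi (- int (n * (n + 2))) *
    (qpoch q q (2 * n + 1) / (qpoch q q (n - r) * qpoch q q (n + r + 1))) else 0"
  defines "g \<equiv> \<lambda>n. if r < n then (q - q powi (- 2 * int r - 3)) * q powi (- int (n * n)) *
    (qpoch q q (2 * n + 1) / (qpoch q q (n - r - 1) * qpoch q q (n + r + 3))) else 0"
  shows "t (r + 3) n - q powi (- 2 * int r - 4) * t r n = g (Suc n) - g n"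
proof -
  have nz: "qpoch q q l \<noteq> 0" if "l \<le> 2 * r + i + 4" for l
    using assms(1) that by (rule qpoch_nonzero_mono)
  have nz1: "1 - q ^ Suc l \<noteq> 0" if "l \<le> 2 * r + i + 3" for l
    using nz[of "Suc l"] that by (simp add: qpoch_Suc)
  have powi: "q powi (x + y) = q powi x * q powi y" for x y
    using assms(2) by (simp add: power_int_add)
  define X Y where "X = q ^ i" and "Y = q ^ r"
  have "Y \<noteq> 0"
    using assms(2) by (simp add: Y_def)
  \<comment> \<open>The common factor of \<open>t r n\<close>, \<open>t (r + 3) n\<close>,
    \<open>g n\<close> and \<open>g (Suc n)\<close>; each of them is \<open>c\<close> times a
    rational function of q, X and Y.\<close>
  define c where "c = q powi (- int (n * (n + 2))) * qpoch q q (2 * n + 1) /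
    (qpoch q q i * qpoch q q (n + r + 4))"
  have Q4: "qpoch q q (n + r + 4) = qpoch q q (n + r + 1) *
      ((1 - X * Y ^ 2 * q ^ 2) * (1 - X * Y ^ 2 * q ^ 3) * (1 - X * Y ^ 2 * q ^ 4))"
    by (simp add: numeral_eq_Suc qpoch_Suc X_def Y_def n_def power_add mult_ac)
  have Q3: "qpoch q q (n + r + 4) = qpoch q q (n + r + 3) * (1 - X * Y ^ 2 * q ^ 4)"
    by (simp add: numeral_eq_Suc qpoch_Suc X_def Y_def n_def power_add mult_ac)
  have nz4: "qpoch q q (n + r + 4) \<noteq> 0"
    by (rule nz) (simp add: n_def)
  have t0: "t r n = c * ((1 - X * Y ^ 2 * q ^ 2) * (1 - X * Y ^ 2 * q ^ 3) * (1 - X * Y ^ 2 * q ^ 4))"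
    using nz4 unfolding c_def Q4 by (simp add: t_def n_def)
  have t3: "t (r + 3) n = c * ((1 - X) * (1 - X / q) * (1 - X / q ^ 2))"
  proof -
    \<comment> \<open>For i < 3 the left side is 0 by the default value of \<open>t\<close>, and on
      the right one of the factors 1 - X, 1 - X/q, 1 - X/q^2 is 0.\<close>
    consider "i = 0" | "i = 1" | "i = 2" | j where "i = j + 3"
      by (metis add.commute le_Suc_ex less_2_cases_iff not_less_eq_eq numeral_3_eq_3 One_nat_def
          Suc_1 nat_less_le leI)
    then show ?thesis
    proof cases
      case (4 j)
      define P where "P = (1 - X) * (1 - X / q) * (1 - X / q ^ 2)"
      have Qi: "qpoch q q i = qpoch q q j * P"
        using assms(2) by (simp add: 4 X_def P_def numeral_eq_Suc qpoch_Suc)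
      then have "P \<noteq> 0"
        using nz[of i] by auto
      then show ?thesis
        unfolding P_def [symmetric] c_def Qi by (simp add: t_def n_def 4 add_ac)
    qed (use assms(2) in \<open>simp_all add: t_def n_def X_def\<close>)
  qed
  have g0: "g n = (q - q powi (- 2 * int r - 3)) * c * (X ^ 2 * Y ^ 2 * (1 - X) * (1 - X * Y ^ 2 * q ^ 4))"
  proof (cases i)
    case 0
    then show ?thesis by (simp add: g_def n_def X_def)
  next
    case (Suc j)
    have "q powi (- int (n * n)) = q powi (- int (n * (n + 2)) + int (2 * n))"
      by (simp add: algebra_simps)
    also have "\<dots> = q powi (- int (n * (n + 2))) * (X ^ 2 * Y ^ 2)"
      unfolding powi by (simp add: power_int_of_nat X_def Y_def n_def power_add power_mult mult.commute power_mult_distrib del: of_nat_mult of_nat_add flip: power_mult)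
    finally have "q powi (- int (n * n)) = q powi (- int (n * (n + 2))) * (X ^ 2 * Y ^ 2)" .
    moreover have "qpoch q q i = qpoch q q j * (1 - X)"
      by (simp add: Suc X_def qpoch_Suc)
    moreover have "1 - X \<noteq> 0" "1 - X * Y ^ 2 * q ^ 4 \<noteq> 0"
      using nz[of i] nz4 Q3 \<open>qpoch q q i = qpoch q q j * (1 - X)\<close> by auto
    ultimately show ?thesis
      unfolding c_def Q3 by (simp add: g_def n_def Suc)
  qed
  have g1: "g (Suc n) = (q - q powi (- 2 * int r - 3)) * c *
      ((1 - X ^ 2 * Y ^ 2 * q ^ 2) * (1 - X ^ 2 * Y ^ 2 * q ^ 3) / q)"
  proof -
    have "q powi (- int (Suc n * Suc n)) = q powi (- int (n * (n + 2)) + - 1)"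
      by (simp add: algebra_simps)
    also have "\<dots> = q powi (- int (n * (n + 2))) / q"
      unfolding powi by (simp add: power_int_minus field_simps)
    finally have "q powi (- int (Suc n * Suc n)) = q powi (- int (n * (n + 2))) / q" .
    moreover have "qpoch q q (2 * Suc n + 1) =
        qpoch q q (2 * n + 1) * ((1 - X ^ 2 * Y ^ 2 * q ^ 2) * (1 - X ^ 2 * Y ^ 2 * q ^ 3))"
      by (simp add: numeral_eq_Suc qpoch_Suc X_def Y_def n_def power_add mult_ac)
    moreover have "Suc n - r - 1 = i" "Suc n + r + 3 = n + r + 4" "r < Suc n"
      by (simp_all add: n_def)
    ultimately show ?thesis
      unfolding g_def c_def by (simp only: if_True) (simp add: mult_ac)
  qed
  have e4: "q powi (- 2 * int r - 4) = 1 / (Y ^ 2 * q ^ 4)"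
  proof -
    have "- 2 * int r - 4 = - int (r * 2 + 4)"
      by simp
    then show ?thesis
      by (simp only: power_int_minus power_int_of_nat power_add power_mult Y_def) (simp add: divide_inverse)
  qed
  have e3: "q powi (- 2 * int r - 3) = 1 / (Y ^ 2 * q ^ 3)"
  proof -
    have "- 2 * int r - 3 = - int (r * 2 + 3)"
      by simp
    then show ?thesis
      by (simp only: power_int_minus power_int_of_nat power_add power_mult Y_def) (simp add: divide_inverse)
  qed
  have "t (r + 3) n - q powi (- 2 * int r - 4) * t r n = c * ((1 - X) * (1 - X / q) * (1 - X / q ^ 2) -
      (1 - X * Y ^ 2 * q ^ 2) * (1 - X * Y ^ 2 * q ^ 3) * (1 - X * Y ^ 2 * q ^ 4) / (Y ^ 2 * q ^ 4))"
  proof -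
    have "c * x - 1 / w * (c * y) = c * (x - y / w)" for x y w
      by (simp add: right_diff_distrib)
    then show ?thesis
      unfolding t0 t3 e4 .
  qed
  also have "\<dots> = g (Suc n) - g n"
  proof -
    have "c * (z * (x - y)) = z * c * x - z * c * y" for x y z
      by (simp add: right_diff_distrib)
    then show ?thesis
      unfolding qsum_telescoping_identity[OF assms(2) \<open>Y \<noteq> 0\<close>] g0 g1 e3 .
  qed
  finally show ?thesis .
qed

text \<open>This and the next three identities evaluate G_r near the top of its range, once q^N = 1
  has removed r from the exponents: three terms for r = \<open>N div 2 - 3\<close>, two terms
  (suffix \<open>_2\<close>) for r = \<open>N div 2 - 2\<close>. The names refer to the parity of
  N.\<close>

lemma qsum_even_identity:
  fixes u :: "'a :: field"
  assumes "u \<noteq> 0" "1 - u \<noteq> 0" "1 - u ^ 2 \<noteq> 0"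
  shows "1 / u ^ 3 + (1 - 1 / u ^ 3) / (1 - u) +
    u * ((1 - 1 / u ^ 2) * (1 - 1 / u) / ((1 - u) * (1 - u ^ 2))) = - 1 / u"
  using assms by (simp add: divide_simps) algebra

lemma qsum_odd_identity:
  fixes u :: "'a :: field"
  assumes "u \<noteq> 0" "1 - u \<noteq> 0" "1 - u ^ 2 \<noteq> 0"
  shows "1 / u ^ 5 + 1 / u * ((1 - 1 / u ^ 4) / (1 - u)) +
    u * ((1 - 1 / u ^ 3) * (1 - 1 / u ^ 2) / ((1 - u) * (1 - u ^ 2))) = 0"
  using assms by (simp add: divide_simps) algebra

lemma qsum_odd_identity_2:
  fixes u :: "'a :: field"
  assumes "u \<noteq> 0" "1 - u \<noteq> 0"
  shows "1 / u + u * ((1 - 1 / u ^ 2) / (1 - u)) = - 1"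
  using assms by (simp add: divide_simps) algebra

lemma qsum_even_identity_2:
  fixes u :: "'a :: field"
  assumes "u \<noteq> 0" "1 - u \<noteq> 0"
  shows "1 + u * ((1 - 1 / u) / (1 - u)) = 0"
  using assms by (simp add: divide_simps)

section \<open>Primitive roots of unity\<close>

definition alpha_monomial :: "complex \<Rightarrow> nat \<Rightarrow> complex" where
  "alpha_monomial q k =
    (if k mod 3 = 1 then 0 else (-1) ^ ((4 * k + 1) div 3) * q ^ (k * (2 * k - 1) div 3))"

lemma alpha_conv_monomial: "(1 - q) * alpha q k = alpha_monomial q k * (1 - q ^ (2 * k + 1))"
proof -
  have "(1 - q) * (\<Sum>j\<le>2 * k. q ^ j) = 1 - q ^ (2 * k + 1)"
    using sum_gp_basic[of q "2 * k"] by simp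
  then show ?thesis
    by (simp add: alpha_def alpha_monomial_def mult.left_commute del: power_Suc)
qed

lemma mod_3_cases: "\<exists>l. (k :: nat) = 3 * l \<or> k = 3 * l + 1 \<or> k = 3 * l + 2"
  by presburger

text \<open>Separating the residues modulo 3 removes the floor and the division; the exponents
  become integer polynomials in l that can be compared modulo N.\<close>

lemma alpha_monomial_3:
  shows "alpha_monomial q (3 * l) = q powi (int l * (6 * int l - 1))"
    and "alpha_monomial q (3 * l + 1) = 0"
    and "alpha_monomial q (3 * l + 2) = - (q powi ((3 * int l + 2) * (2 * int l + 1)))"
proof -
  have "(4 * (3 * l) + 1) div 3 = 2 * (2 * l)"
    by simp
  moreover have "3 * l * (2 * (3 * l) - 1) div 3 = l * (6 * l - 1)"
    by (simp add: mult.assoc)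
  ultimately have "alpha_monomial q (3 * l) = q ^ (l * (6 * l - 1))"
    by (simp add: alpha_monomial_def)
  \<comment> \<open>At l = 0 the truncated \<open>6 * l - 1\<close> is 0 instead of -1; the factor l
    makes this harmless.\<close>
  moreover have "int (l * (6 * l - 1)) = int l * (6 * int l - 1)"
    by (cases l) (simp_all add: algebra_simps)
  ultimately show "alpha_monomial q (3 * l) = q powi (int l * (6 * int l - 1))"
    by (metis power_int_of_nat)
next
  show "alpha_monomial q (3 * l + 1) = 0"
    by (simp add: alpha_monomial_def)
next
  have "(4 * (3 * l + 2) + 1) div 3 = Suc (2 * (2 * l + 1))"
    by simp
  moreover have "(3 * l + 2) * (2 * (3 * l + 2) - 1) div 3 = (3 * l + 2) * (2 * l + 1)"
  proof -
    have "(3 * l + 2) * (2 * (3 * l + 2) - 1) = 3 * ((3 * l + 2) * (2 * l + 1))"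
      by (simp add: algebra_simps)
    then show ?thesis by simp
  qed
  moreover have "(3 * int l + 2) * (2 * int l + 1) = int ((3 * l + 2) * (2 * l + 1))"
    by (simp only: of_nat_mult of_nat_add of_nat_numeral of_nat_1)
  moreover have "(3 * l + 2) mod 3 = 2"
    by presburger
  ultimately show "alpha_monomial q (3 * l + 2) = - (q powi ((3 * int l + 2) * (2 * int l + 1)))"
    unfolding alpha_monomial_def by (simp only: power_int_of_nat) simp
qed

locale primitive_root =
  fixes N :: nat and q :: complex
  assumes primitive: "primitive_root_of_unity N q"
begin

lemma N_pos: "N > 0"
  and q_power_N: "q ^ N = 1"
  and q_power_neq_1: "0 < m \<Longrightarrow> m < N \<Longrightarrow> q ^ m \<noteq> 1"
  using primitive by (auto simp: primitive_root_of_unity_def)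

lemma q_nonzero: "q \<noteq> 0"
  using N_pos q_power_N by (metis power_0_left zero_neq_one less_irrefl)

lemma qpoch_nonzero: "l < N \<Longrightarrow> qpoch q q l \<noteq> 0"
  by (auto simp: qpoch_eq_0_iff dest: q_power_neq_1)

lemma qpoch_zero: "N \<le> l \<Longrightarrow> qpoch q q l = 0"
  using N_pos q_power_N by (auto simp: qpoch_eq_0_iff)

lemma powi_add: "q powi (x + y) = q powi x * q powi y"
  using q_nonzero by (simp add: power_int_add)

text \<open>Exponents matter only modulo N. Naming the multiplier \<open>w\<close> reduces each such
  comparison to an identity between integers.\<close>

lemma powi_eqI:
  assumes "x = y + int N * w"
  shows "q powi x = q powi y"
  unfolding assms powi_add power_int_mult by (simp add: q_power_N)

lemma qsum_step:
  assumes "r + 3 < N div 2"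
  shows "qsum q (N div 2) r = q powi (2 * int r + 4) * qsum q (N div 2) (r + 3)"
proof -
  define M where "M = N div 2"
  define t where "t r n = (if r \<le> n then q powi (- int (n * (n + 2))) *
    (qpoch q q (2 * n + 1) / (qpoch q q (n - r) * qpoch q q (n + r + 1))) else 0)" for r n
  define g where "g n = (if r < n then (q - q powi (- 2 * int r - 3)) * q powi (- int (n * n)) *
    (qpoch q q (2 * n + 1) / (qpoch q q (n - r - 1) * qpoch q q (n + r + 3))) else 0)" for n
  \<comment> \<open>Padding with zeros gives the sums for r and r+3 the same range.\<close>
  have qsum_t: "qsum q M s = (\<Sum>n=r..<M. t s n)" if "r \<le> s" for s
    unfolding qsum_def by (rule sum.mono_neutral_cong_left) (use that in \<open>auto simp: t_def\<close>)
  have "qsum q M (r + 3) - q powi (- 2 * int r - 4) * qsum q M r =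
      (\<Sum>n=r..<M. t (r + 3) n - q powi (- 2 * int r - 4) * t r n)"
    by (simp add: qsum_t sum_subtractf sum_distrib_left)
  also have "\<dots> = (\<Sum>n=r..<M. g (Suc n) - g n)"
  proof (rule sum.cong [OF refl])
    fix n assume n: "n \<in> {r..<M}"
    then obtain i where i: "n = r + i"
      using le_Suc_ex by auto
    \<comment> \<open>The largest index r+n+4 of a denominator stays below N since r+4 and n+1 are
      both at most \<open>N div 2\<close>.\<close>
    have "2 * r + i + 4 < N"
      using assms n by (simp add: i M_def)
    then show "t (r + 3) n - q powi (- 2 * int r - 4) * t r n = g (Suc n) - g n"
      unfolding t_def g_def i by (intro qsum_term_telescoping qpoch_nonzero q_nonzero)
  qed
  also have "\<dots> = g M - g r"
    using assms by (intro sum_Suc_diff') (simp add: M_def)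
  also have "\<dots> = 0"
    using qpoch_zero[of "2 * M + 1"] by (simp add: g_def M_def)
  finally have "qsum q M (r + 3) = q powi (- 2 * int r - 4) * qsum q M r"
    by simp
  then show ?thesis
    by (simp add: M_def [symmetric] powi_add [symmetric] mult.assoc [symmetric])
qed

text \<open>From k to k+3 the exponent k(2k-1)/3 grows by 4k+5, and the floor in the sign grows by
  the even number 4.\<close>

lemma alpha_monomial_add_3: "alpha_monomial q (k + 3) = q powi (4 * int k + 5) * alpha_monomial q k"
proof -
  obtain l where "k = 3 * l \<or> k = 3 * l + 1 \<or> k = 3 * l + 2"
    using mod_3_cases by blast
  then consider "k = 3 * l" | "k = 3 * l + 1" | "k = 3 * l + 2"
    by blast
  then show ?thesis
  proof cases
    case 1
    then have "k + 3 = 3 * (l + 1)"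
      by simp
    then show ?thesis
      unfolding 1 by (simp only: alpha_monomial_3 powi_add [symmetric]) (simp add: algebra_simps)
  next
    case 2
    then have "k + 3 = 3 * (l + 1) + 1"
      by simp
    then show ?thesis
      unfolding 2 by (simp only: alpha_monomial_3) simp
  next
    case 3
    then have "k + 3 = 3 * (l + 1) + 2"
      by simp
    then show ?thesis
      unfolding 3 by (simp only: alpha_monomial_3 powi_add [symmetric] mult_minus_right) (simp add: algebra_simps)
  qed
qed

text \<open>The combination of the coefficients at \<open>r\<close> and \<open>N - 1 - r\<close> that remains
  when the right-hand side of the theorem is folded under this reflection.\<close>

definition alpha_fold :: "nat \<Rightarrow> complex" where
  "alpha_fold r = alpha_monomial q r - q powi (- 2 * int r - 1) * alpha_monomial q (N - 1 - r)"

text \<open>While r moves to r+3, the mirror index moves from s+3 back to s. The factors that the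
  two monomials acquire have exponents differing by 4N, so they coincide.\<close>

lemma alpha_fold_add_3:
  assumes "r + 3 < N"
  shows "alpha_fold (r + 3) = q powi (4 * int r + 5) * alpha_fold r"
proof -
  obtain s where s: "N = r + s + 4"
    using less_imp_Suc_add[OF assms] by auto
  then have 1: "N - 1 - r = s + 3" "N - 1 - (r + 3) = s"
    by auto
  have "q powi (- 2 * int (r + 3) - 1) =
      q powi ((4 * int r + 5) + ((- 2 * int r - 1) + (4 * int s + 5)))"
    by (rule powi_eqI[of _ _ "-4"]) (simp add: s algebra_simps)
  then show ?thesis
    unfolding alpha_fold_def 1 alpha_monomial_add_3 powi_add by (simp add: algebra_simps)
qed

text \<open>Reflection swaps the two monomials, and -2s-1 differs from 2r+1 by 2N.\<close>

lemma alpha_fold_reflect: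
  assumes "r + s + 1 = N"
  shows "alpha_fold s = - (q powi (2 * int r + 1)) * alpha_fold r"
proof -
  have 1: "N - 1 - r = s" "N - 1 - s = r"
    using assms by auto
  have "q powi (- 2 * int s - 1) = q powi (2 * int r + 1)"
    by (rule powi_eqI[of _ _ "-2"]) (simp add: assms [symmetric] algebra_simps)
  moreover have "q powi (2 * int r + 1) * q powi (- 2 * int r - 1) = 1"
    by (simp flip: powi_add)
  ultimately show ?thesis
    unfolding alpha_fold_def 1 by (simp add: right_diff_distrib mult.assoc [symmetric])
qed

section \<open>The folded coefficient at the middle index \<open>N div 2 - 1\<close>\<close>

lemma q_power_half:
  assumes "N = 2 * M"
  shows "q ^ M = -1"
proof -
  have "(q ^ M) ^ 2 = 1"
    using q_power_N by (simp add: assms power_mult mult.commute)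
  moreover have "q ^ M \<noteq> 1"
    using N_pos by (intro q_power_neq_1) (auto simp: assms)
  ultimately show ?thesis
    by (simp add: power2_eq_1_iff)
qed

lemma powi_eqI_half:
  assumes "N = 2 * M" "x = y + int M * (2 * w + 1)"
  shows "q powi x = - (q powi y)"
proof -
  have "x = y + (int M + int N * w)"
    by (simp add: assms algebra_simps)
  then have "q powi x = q powi y * (q powi int M * q powi (int N * w))"
    by (simp only: powi_add)
  also have "q powi (int N * w) = q powi 0"
    by (rule powi_eqI[of _ _ w]) simp
  finally show ?thesis
    using q_power_half[OF assms(1)] by simp
qed

text \<open>The fold pairs m with m+1. Unless m = 2 modulo 3, one of the two monomials is zero and
  the other gives the value; otherwise both survive and a sixth root of unity merges them.\<close>

lemma alpha_fold_middle_even: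
  assumes "N = 2 * Suc m"
  shows "alpha_fold m = - (q powi (- 2 * int m - 1))"
proof -
  have *: "alpha_fold m = alpha_monomial q m - q powi (- 2 * int m - 1) * alpha_monomial q (Suc m)"
    unfolding alpha_fold_def using assms by simp
  obtain l where "m = 3 * l \<or> m = 3 * l + 1 \<or> m = 3 * l + 2"
    using mod_3_cases by blast
  then consider "m = 3 * l" | "m = 3 * l + 1" | "m = 3 * l + 2"
    by blast
  then show ?thesis
  proof cases
    case 1
    have "q powi (int l * (6 * int l - 1)) = - (q powi (- 2 * int m - 1))"
      by (rule powi_eqI_half[OF assms, where w = "int l"]) (simp add: 1 algebra_simps)
    then have "alpha_monomial q m = - (q powi (- 2 * int m - 1))"
      using alpha_monomial_3(1)[of q l] by (simp add: 1)
    moreover have "alpha_monomial q (Suc m) = 0"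
      using alpha_monomial_3(2)[of q l] by (simp add: 1)
    ultimately show ?thesis
      unfolding * by simp
  next
    case 2
    have "q powi ((3 * int l + 2) * (2 * int l + 1)) = - (q powi 0)"
      by (rule powi_eqI_half[OF assms, where w = "int l"]) (simp add: 2 algebra_simps)
    then have "alpha_monomial q (Suc m) = 1"
      using alpha_monomial_3(3)[of q l] by (simp add: 2)
    moreover have "alpha_monomial q m = 0"
      using alpha_monomial_3(2)[of q l] by (simp add: 2)
    ultimately show ?thesis
      unfolding * by simp
  next
    case 3
    \<comment> \<open>Here N = 6(l+1), so z is a primitive sixth root of unity and z^2 + 1 = z
      combines the two monomials into one.\<close>
    define z where "z = q ^ (l + 1)"
    have "(l + 1) * 3 = Suc m"
      by (simp add: 3)
    then have "z ^ 3 = -1"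
      using q_power_half[OF assms] by (simp only: z_def power_mult [symmetric])
    moreover have "z \<noteq> -1"
    proof
      assume "z = -1"
      then have "q ^ ((l + 1) * 2) = 1"
        unfolding power_mult z_def [symmetric] by simp
      then show False
        using q_power_neq_1[of "(l + 1) * 2"] by (simp add: assms 3)
    qed
    moreover have "(z + 1) * (z ^ 2 - z + 1) = z ^ 3 + 1"
      by algebra
    ultimately have z: "z ^ 2 - z + 1 = 0"
      by (metis add.right_inverse add_eq_0_iff mult_eq_0_iff add.commute)
    have z1: "z = q powi (int l + 1)" "z ^ 2 = q powi (2 * int l + 2)"
    proof -
      have "z ^ 2 = q ^ (2 * l + 2)"
        unfolding z_def power_mult [symmetric] by (rule arg_cong) simp
      then have "z = q powi int (l + 1)" "z ^ 2 = q powi int (2 * l + 2)"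
        by (simp_all only: power_int_of_nat z_def)
      then show "z = q powi (int l + 1)" "z ^ 2 = q powi (2 * int l + 2)"
        by (simp_all add: add.commute)
    qed
    define E where "E = q powi (- int l)"
    have "alpha_monomial q m = - (E * z ^ 2)"
      unfolding 3 alpha_monomial_3 z1(2) E_def powi_add [symmetric]
      by (rule arg_cong[where f = uminus], rule powi_eqI[of _ _ "int l"]) (simp add: 3 assms algebra_simps)
    moreover have "q powi (- 2 * int m - 1) * alpha_monomial q (Suc m) = E"
    proof -
      have "Suc m = 3 * (l + 1)"
        by (simp add: 3)
      then show ?thesis
        unfolding E_def by (simp only: alpha_monomial_3 powi_add [symmetric])
          (rule powi_eqI[of _ _ "int l"], simp add: 3 assms algebra_simps)
    qed
    ultimately have "alpha_fold m = - (E * z ^ 2) - E"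
      unfolding * by (simp only:)
    then have "alpha_fold m = - (E * z)"
      using z by algebra
    also have "E * z = q powi (- 2 * int m - 1)"
      unfolding z1 E_def powi_add [symmetric]
      by (rule powi_eqI[of _ _ 1]) (simp add: 3 assms algebra_simps)
    finally show ?thesis .
  qed
qed

text \<open>As for even N, except that m is paired with m+2, so both monomials survive when m = 0
  modulo 3.\<close>

lemma alpha_fold_middle_odd:
  assumes "N = 2 * Suc m + 1"
  shows "alpha_fold m = - (q powi (- 2 * int m - 1))"
proof -
  have *: "alpha_fold m = alpha_monomial q m - q powi (- 2 * int m - 1) * alpha_monomial q (m + 2)"
    unfolding alpha_fold_def using assms by simp
  obtain l where "m = 3 * l \<or> m = 3 * l + 1 \<or> m = 3 * l + 2"
    using mod_3_cases by blast
  then consider "m = 3 * l" | "m = 3 * l + 1" | "m = 3 * l + 2"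
    by blast
  then show ?thesis
  proof cases
    case 1
    \<comment> \<open>Here N = 3(2l+1), so z is a primitive cube root of unity and 1 + z = -z^2
      combines the monomials.\<close>
    define z where "z = q ^ (2 * l + 1)"
    have "(2 * l + 1) * 3 = N"
      by (simp add: 1 assms)
    then have "z ^ 3 = 1"
      using q_power_N by (simp only: z_def power_mult [symmetric])
    moreover have "z \<noteq> 1"
      unfolding z_def by (rule q_power_neq_1) (simp_all add: assms 1)
    moreover have "(z - 1) * (z ^ 2 + z + 1) = z ^ 3 - 1"
      by algebra
    ultimately have z: "z ^ 2 + z + 1 = 0"
      by (metis right_minus_eq mult_eq_0_iff)
    have z1: "z = q powi (2 * int l + 1)" "z ^ 2 = q powi (4 * int l + 2)"
    proof -
      have "z ^ 2 = q ^ (4 * l + 2)"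
        unfolding z_def power_mult [symmetric] by (rule arg_cong) simp
      then have "z = q powi int (2 * l + 1)" "z ^ 2 = q powi int (4 * l + 2)"
        by (simp_all only: power_int_of_nat z_def)
      then show "z = q powi (2 * int l + 1)" "z ^ 2 = q powi (4 * int l + 2)"
        by (simp_all add: add.commute)
    qed
    define E where "E = q powi (- 4 * int l)"
    have "alpha_monomial q m = E"
      unfolding 1 alpha_monomial_3 E_def
      by (rule powi_eqI[of _ _ "int l"]) (simp add: 1 assms algebra_simps)
    moreover have "q powi (- 2 * int m - 1) * alpha_monomial q (m + 2) = - (E * z)"
      unfolding 1 alpha_monomial_3 z1 E_def mult_minus_right powi_add [symmetric]
      by (rule arg_cong[where f = uminus], rule powi_eqI[of _ _ "int l"]) (simp add: 1 assms algebra_simps)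
    ultimately have "alpha_fold m = E - - (E * z)"
      unfolding * by (simp only:)
    then have "alpha_fold m = - (E * z ^ 2)"
      using z by algebra
    also have "E * z ^ 2 = q powi (- 2 * int m - 1)"
      unfolding z1(2) E_def powi_add [symmetric]
      by (rule powi_eqI[of _ _ 1]) (simp add: 1 assms algebra_simps)
    finally show ?thesis .
  next
    case 2
    have "q powi ((int l + 1) * (6 * int l + 5)) = q powi 0"
      by (rule powi_eqI[of _ _ "int l + 1"]) (simp add: 2 assms algebra_simps)
    moreover have "m + 2 = 3 * (l + 1)" "6 * int (l + 1) - 1 = 6 * int l + 5" "int (l + 1) = int l + 1"
      by (simp_all add: 2)
    ultimately show ?thesis
      unfolding * using 2 by (simp only: alpha_monomial_3) simp
  next
    case 3
    have "q powi ((3 * int l + 2) * (2 * int l + 1)) = q powi (- 2 * int m - 1)"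
      by (rule powi_eqI[of _ _ "int l + 1"]) (simp add: 3 assms algebra_simps)
    moreover have "m + 2 = 3 * (l + 1) + 1"
      by (simp add: 3)
    ultimately show ?thesis
      unfolding * using 3 by (simp only: alpha_monomial_3) simp
  qed
qed

lemma alpha_fold_middle:
  assumes "m + 1 = N div 2"
  shows "alpha_fold m = - (q powi (- 2 * int m - 1))"
proof (cases "even N")
  case True
  then show ?thesis using assms by (intro alpha_fold_middle_even) auto
next
  case False
  then show ?thesis using assms by (intro alpha_fold_middle_odd) (auto elim!: oddE)
qed

section \<open>The three initial values at the top of the range\<close>

lemma qsum_last:
  assumes "m + 1 = N div 2"
  shows "qsum q (N div 2) m = q powi (- int (m * (m + 2)))"
proof -
  have "2 * m + 1 < N"
    using assms by auto
  then show ?thesis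
    unfolding qsum_def assms [symmetric] using qpoch_nonzero[of "2 * m + 1"]
    by (simp del: of_nat_mult of_nat_add add: mult_2)
qed

lemma qsum_last_2:
  assumes "m + 2 = N div 2"
  shows "qsum q (N div 2) m = q powi (- int (m * (m + 2))) +
    q powi (- int ((m + 1) * (m + 3))) * ((1 - q ^ (2 * m + 3)) / (1 - q))"
proof -
  have "2 * m + 3 < N"
    using assms by auto
  then have nz: "qpoch q q l \<noteq> 0" if "l \<le> 2 * m + 3" for l
    using qpoch_nonzero[of l] that by linarith
  have "{m..<N div 2} = {m, m + 1}"
    using assms by auto
  moreover have "qpoch q q (2 * m + 3) = qpoch q q (2 * m + 2) * (1 - q ^ (2 * m + 3))"
    using qpoch_Suc[of q "2 * m + 2"] by (simp add: numeral_3_eq_3)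
  moreover have "qpoch q q 1 = 1 - q"
    by (simp add: qpoch_def)
  ultimately show ?thesis
    unfolding qsum_def using nz[of "2 * m + 1"] nz[of "2 * m + 2"]
    by (simp del: of_nat_mult of_nat_add add: mult_2 eval_nat_numeral add_ac)
qed

lemma qsum_last_3:
  assumes "m + 3 = N div 2"
  shows "qsum q (N div 2) m = q powi (- int (m * (m + 2))) +
    q powi (- int ((m + 1) * (m + 3))) * ((1 - q ^ (2 * m + 3)) / (1 - q)) +
    q powi (- int ((m + 2) * (m + 4))) *
      ((1 - q ^ (2 * m + 4)) * (1 - q ^ (2 * m + 5)) / ((1 - q) * (1 - q ^ 2)))"
proof -
  have "2 * m + 5 < N"
    using assms by auto
  then have nz: "qpoch q q l \<noteq> 0" if "l \<le> 2 * m + 5" for l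
    using qpoch_nonzero[of l] that by linarith
  have "{m..<N div 2} = {m, m + 1, m + 2}"
    using assms by auto
  moreover have "qpoch q q (2 * m + 3) = qpoch q q (2 * m + 2) * (1 - q ^ (2 * m + 3))"
    using qpoch_Suc[of q "2 * m + 2"] by (simp add: numeral_3_eq_3)
  moreover have "qpoch q q (2 * m + 5) = qpoch q q (2 * m + 3) * ((1 - q ^ (2 * m + 4)) * (1 - q ^ (2 * m + 5)))"
    using qpoch_Suc[of q "2 * m + 4"] qpoch_Suc[of q "2 * m + 3"]
    by (simp add: eval_nat_numeral mult.assoc)
  moreover have "qpoch q q 1 = 1 - q" "qpoch q q 2 = (1 - q) * (1 - q ^ 2)"
    by (simp_all add: qpoch_def eval_nat_numeral)
  ultimately show ?thesis
    unfolding qsum_def using nz[of "2 * m + 1"] nz[of "2 * m + 2"] nz[of "2 * m + 3"]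
    by (simp del: of_nat_mult of_nat_add add: mult_2 eval_nat_numeral add_ac)
qed

lemma q_power_compl: "k + j = N \<Longrightarrow> q ^ k = 1 / q ^ j"
  using q_power_N q_nonzero by (simp add: field_simps flip: power_add)

lemma powi_diff_eqI: "x = y - int k + int N * w \<Longrightarrow> q powi x = q powi y * (1 / q ^ k)"
  using powi_eqI[of x "y - int k" w] q_nonzero by (simp add: power_int_diff)

lemma powi_inverseI: "q powi x * a = 1 \<Longrightarrow> a = q powi (- x)"
  unfolding power_int_minus by (rule inverse_unique [symmetric])

text \<open>The recurrence leads past the middle to m+3, and reflection leads back. For even N, m+3
  is the mirror of m itself and the signs conflict, which forces 0; for odd N it is the mirror of
  the middle index m+1.\<close>

lemma alpha_fold_last_2:
  assumes "m + 2 = N div 2"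
  shows "alpha_fold m = (if even N then 0 else q powi (- 4 * int m - 5))"
proof -
  have 1: "alpha_fold (m + 3) = q powi (4 * int m + 5) * alpha_fold m"
    using assms by (intro alpha_fold_add_3) auto
  show ?thesis
  proof (cases "even N")
    case True
    then have N: "m + (m + 3) + 1 = N"
      using assms by auto
    have "q powi (4 * int m + 5) = q powi (2 * int m + 1)"
      by (rule powi_eqI[of _ _ 1]) (simp flip: N)
    then have "q powi (2 * int m + 1) * alpha_fold m = - (q powi (2 * int m + 1)) * alpha_fold m"
      using 1 alpha_fold_reflect[OF N] by simp
    then show ?thesis
      using True q_nonzero by simp
  next
    case False
    then have N: "(m + 1) + (m + 3) + 1 = N"
      using assms by (auto elim!: oddE)
    have "alpha_fold (m + 1) = - (q powi (- 2 * int (m + 1) - 1))"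
      using assms by (intro alpha_fold_middle) simp
    then have "q powi (4 * int m + 5) * alpha_fold m = q powi (2 * int (m + 1) + 1) * q powi (- 2 * int (m + 1) - 1)"
      using 1 alpha_fold_reflect[OF N] by simp
    also have "\<dots> = 1"
      by (simp flip: powi_add)
    finally have "alpha_fold m = q powi (- (4 * int m + 5))"
      by (rule powi_inverseI)
    then show ?thesis
      using False by simp
  qed
qed

text \<open>The same argument with the parities exchanged: m+3 mirrors the middle index m+2 for even
  N, and is its own mirror for odd N, where the fold equals its negative.\<close>

lemma alpha_fold_last_3:
  assumes "m + 3 = N div 2"
  shows "alpha_fold m = (if even N then q powi (- 4 * int m - 5) else 0)"
proof -
  have 1: "alpha_fold (m + 3) = q powi (4 * int m + 5) * alpha_fold m"
    using assms by (intro alpha_fold_add_3) auto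
  show ?thesis
  proof (cases "even N")
    case True
    then have N: "(m + 2) + (m + 3) + 1 = N"
      using assms by auto
    have "alpha_fold (m + 2) = - (q powi (- 2 * int (m + 2) - 1))"
      using assms by (intro alpha_fold_middle) simp
    then have "q powi (4 * int m + 5) * alpha_fold m = q powi (2 * int (m + 2) + 1) * q powi (- 2 * int (m + 2) - 1)"
      using 1 alpha_fold_reflect[OF N] by simp
    also have "\<dots> = 1"
      by (simp flip: powi_add)
    finally have "alpha_fold m = q powi (- (4 * int m + 5))"
      by (rule powi_inverseI)
    then show ?thesis
      using True by simp
  next
    case False
    then have N: "(m + 3) + (m + 3) + 1 = N"
      using assms by (auto elim!: oddE)
    have "q powi (2 * int (m + 3) + 1) = q powi 0"
      by (rule powi_eqI[of _ _ 1]) (simp flip: N)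
    then have "alpha_fold (m + 3) = - alpha_fold (m + 3)"
      using alpha_fold_reflect[OF N] by simp
    then show ?thesis
      using False 1 q_nonzero by simp
  qed
qed

lemma qsum_eq_alpha_fold_last_2:
  assumes "m + 2 = N div 2"
  shows "qsum q (N div 2) m = - (q powi (1 - int m * int m)) * alpha_fold m"
proof -
  \<comment> \<open>This is q^(-M^2) with M = \<open>N div 2\<close>. Relative to it, q^N = 1 leaves
    exponents free of m, so G_m is B times a fixed rational function of q.\<close>
  define B where "B = q powi (- ((int m + 2) * (int m + 2)))"
  have nz: "1 - q \<noteq> 0"
    using q_power_neq_1[of 1] assms by auto
  have 2: "q powi (- int ((m + 1) * (m + 3))) = B * q"
    using powi_add[of "- ((int m + 2) * (int m + 2))" 1] by (simp add: B_def algebra_simps)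
  show ?thesis
  proof (cases "even N")
    case True
    then have N: "N = 2 * m + 4"
      using assms by auto
    have 1: "q powi (- int (m * (m + 2))) = B"
      unfolding B_def by (rule powi_eqI[of _ _ 1]) (simp add: N algebra_simps)
    have 3: "q ^ (2 * m + 3) = 1 / q"
      using q_power_compl[of "2 * m + 3" 1] by (simp add: N)
    have "qsum q (N div 2) m = B * (1 + q * ((1 - 1 / q) / (1 - q)))"
      unfolding qsum_last_2[OF assms] 1 2 3 by (simp add: distrib_left)
    then show ?thesis
      unfolding qsum_even_identity_2[OF q_nonzero nz] using True by (simp add: alpha_fold_last_2[OF assms])
  next
    case False
    then have N: "N = 2 * m + 5"
      using assms by (auto elim!: oddE)
    have 1: "q powi (- int (m * (m + 2))) = B * (1 / q ^ 1)"
      unfolding B_def by (rule powi_diff_eqI[of _ _ _ 1]) (simp add: N algebra_simps)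
    have 3: "q ^ (2 * m + 3) = 1 / q ^ 2"
      by (rule q_power_compl) (simp add: N)
    have "qsum q (N div 2) m = B * (1 / q + q * ((1 - 1 / q ^ 2) / (1 - q)))"
      unfolding qsum_last_2[OF assms] 1 2 3 by (simp add: distrib_left)
    then have "qsum q (N div 2) m = - B"
      unfolding qsum_odd_identity_2[OF q_nonzero nz] by simp
    moreover have "B = q powi (1 - int m * int m) * q powi (- 4 * int m - 5)"
      unfolding B_def powi_add [symmetric] by (simp add: algebra_simps)
    ultimately show ?thesis
      using False by (simp add: alpha_fold_last_2[OF assms])
  qed
qed

lemma qsum_eq_alpha_fold_last_3:
  assumes "m + 3 = N div 2"
  shows "qsum q (N div 2) m = - (q powi (1 - int m * int m)) * alpha_fold m"
proof -
  define B where "B = q powi (- ((int m + 3) * (int m + 3)))"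
  have nz: "1 - q \<noteq> 0" "1 - q ^ 2 \<noteq> 0"
    using q_power_neq_1[of 1] q_power_neq_1[of 2] assms by auto
  have 3: "q powi (- int ((m + 2) * (m + 4))) = B * q"
    using powi_add[of "- ((int m + 3) * (int m + 3))" 1] by (simp add: B_def algebra_simps)
  show ?thesis
  proof (cases "even N")
    case True
    then have N: "N = 2 * m + 6"
      using assms by auto
    have 1: "q powi (- int (m * (m + 2))) = B * (1 / q ^ 3)"
      unfolding B_def by (rule powi_diff_eqI[of _ _ _ 2]) (simp add: N algebra_simps)
    have 2: "q powi (- int ((m + 1) * (m + 3))) = B"
      unfolding B_def by (rule powi_eqI[of _ _ 1]) (simp add: N algebra_simps)
    have 4: "q ^ (2 * m + 3) = 1 / q ^ 3" "q ^ (2 * m + 4) = 1 / q ^ 2" "q ^ (2 * m + 5) = 1 / q"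
      using q_power_compl[of "2 * m + 3" 3] q_power_compl[of "2 * m + 4" 2] q_power_compl[of "2 * m + 5" 1]
      by (simp_all add: N)
    have "qsum q (N div 2) m = B * (1 / q ^ 3 + (1 - 1 / q ^ 3) / (1 - q) +
        q * ((1 - 1 / q ^ 2) * (1 - 1 / q) / ((1 - q) * (1 - q ^ 2))))"
      unfolding qsum_last_3[OF assms] 1 2 3 4 by (simp only: distrib_left mult.assoc)
    also have "\<dots> = - (B * (1 / q ^ 1))"
      unfolding qsum_even_identity[OF q_nonzero nz] by simp
    also have "B * (1 / q ^ 1) = q powi ((1 - int m * int m) + (- 4 * int m - 5))"
      unfolding B_def by (rule powi_diff_eqI[symmetric, of _ _ _ 1]) (simp add: N algebra_simps)
    finally show ?thesis
      using True by (simp only: alpha_fold_last_3[OF assms] powi_add) simp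
  next
    case False
    then have N: "N = 2 * m + 7"
      using assms by (auto elim!: oddE)
    have 1: "q powi (- int (m * (m + 2))) = B * (1 / q ^ 5)"
      unfolding B_def by (rule powi_diff_eqI[of _ _ _ 2]) (simp add: N algebra_simps)
    have 2: "q powi (- int ((m + 1) * (m + 3))) = B * (1 / q ^ 1)"
      unfolding B_def by (rule powi_diff_eqI[of _ _ _ 1]) (simp add: N algebra_simps)
    have 4: "q ^ (2 * m + 3) = 1 / q ^ 4" "q ^ (2 * m + 4) = 1 / q ^ 3" "q ^ (2 * m + 5) = 1 / q ^ 2"
      using q_power_compl[of "2 * m + 3" 4] q_power_compl[of "2 * m + 4" 3] q_power_compl[of "2 * m + 5" 2]
      by (simp_all add: N)
    have "qsum q (N div 2) m = B * (1 / q ^ 5 + 1 / q * ((1 - 1 / q ^ 4) / (1 - q)) +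
        q * ((1 - 1 / q ^ 3) * (1 - 1 / q ^ 2) / ((1 - q) * (1 - q ^ 2))))"
      unfolding qsum_last_3[OF assms] 1 2 3 4 by (simp only: distrib_left mult.assoc power_one_right)
    then show ?thesis
      unfolding qsum_odd_identity[OF q_nonzero nz] using False by (simp add: alpha_fold_last_3[OF assms])
  qed
qed

text \<open>Descent in steps of three. The prefactor reconciles the two recurrences: their exponents
  2r+4 and 4r+5 add up to (r+3)^2 - r^2.\<close>

lemma qsum_eq_alpha_fold:
  assumes "r < N div 2"
  shows "qsum q (N div 2) r = - (q powi (1 - int r * int r)) * alpha_fold r"
  using assms
proof (induction "N div 2 - r" arbitrary: r rule: less_induct)
  case less
  consider "r + 1 = N div 2" | "r + 2 = N div 2" | "r + 3 = N div 2" | "r + 3 < N div 2"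
    using less.prems by linarith
  then show ?case
  proof cases
    case 1
    have "q powi (- int (r * (r + 2))) = q powi (1 - int r * int r) * q powi (- 2 * int r - 1)"
      unfolding powi_add [symmetric] by (simp add: algebra_simps)
    then show ?thesis
      unfolding qsum_last[OF 1] alpha_fold_middle[OF 1] by simp
  next
    case 2
    then show ?thesis by (rule qsum_eq_alpha_fold_last_2)
  next
    case 3
    then show ?thesis by (rule qsum_eq_alpha_fold_last_3)
  next
    case 4
    have "r + 3 < N"
      using 4 by simp
    have "q powi (2 * int r + 4) * (q powi (1 - int (r + 3) * int (r + 3)) * q powi (4 * int r + 5)) =
        q powi (1 - int r * int r)"
      unfolding powi_add [symmetric] by (simp add: algebra_simps)
    moreover have "qsum q (N div 2) (r + 3) = - (q powi (1 - int (r + 3) * int (r + 3))) * alpha_fold (r + 3)"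
      using 4 by (intro less.hyps) auto
    ultimately show ?thesis
      unfolding qsum_step[OF 4] alpha_fold_add_3[OF \<open>r + 3 < N\<close>] by (simp add: mult.assoc [symmetric])
  qed
qed

section \<open>Folding the right-hand side under k -> N-1-k\<close>

text \<open>The quotient of the terms at k+1 and k is -q^(k+1), and the quotients met from the two
  ends multiply to q^N = 1. This leaves r = 0, that is (-1)^(N-1) q^(N choose 2) = 1, which for even
  N rests on q^(N/2) = -1.\<close>

lemma sign_power_choose_reflect:
  assumes "r + s + 1 = N"
  shows "(-1) ^ s * q ^ (s + 1 choose 2) = (-1) ^ r * q ^ (r + 1 choose 2)"
  using assms
proof (induction r arbitrary: s)
  case 0
  then have N: "N = Suc s"
    by simp
  show ?case
  proof (cases "even s")
    case True
    then obtain j where j: "s = 2 * j"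
      by blast
    have "s + 1 choose 2 = N * j"
      by (simp add: choose_two N j)
    then show ?thesis
      using True by (simp add: power_mult q_power_N binomial_eq_0)
  next
    case False
    then obtain j where j: "s = 2 * j + 1"
      by (blast elim: oddE)
    have "s + 1 choose 2 = (j + 1) * s"
      by (simp add: choose_two j)
    moreover have "q ^ (j + 1) = -1"
      by (rule q_power_half) (simp add: N j)
    ultimately have "q ^ (s + 1 choose 2) = (-1) ^ s"
      by (simp only: power_mult)
    then show ?thesis
      using False by (simp add: binomial_eq_0)
  qed
next
  case (Suc r)
  have step: "(-1) ^ Suc k * q ^ (Suc k + 1 choose 2) = - (q ^ (k + 1)) * ((-1) ^ k * q ^ (k + 1 choose 2))" for k
  proof -
    have "Suc k + 1 choose 2 = (k + 1 choose 2) + (k + 1)"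
      by (simp add: numeral_2_eq_2)
    then show ?thesis
      by (simp add: power_add)
  qed
  have "(-1) ^ Suc s * q ^ (Suc s + 1 choose 2) = (-1) ^ r * q ^ (r + 1 choose 2)"
    using Suc.prems by (intro Suc.IH) simp
  then have "(-1) ^ r * q ^ (r + 1 choose 2) = - (q ^ (s + 1)) * ((-1) ^ s * q ^ (s + 1 choose 2))"
    unfolding step by simp
  then have "(-1) ^ Suc r * q ^ (Suc r + 1 choose 2) =
      (q ^ (r + 1) * q ^ (s + 1)) * ((-1) ^ s * q ^ (s + 1 choose 2))"
    unfolding step by simp
  also have "q ^ (r + 1) * q ^ (s + 1) = 1"
    using q_power_N Suc.prems by (simp only: power_add [symmetric]) (simp flip: Suc.prems)
  finally show ?case
    by simp
qed

text \<open>With t = p-1, this is 1 - q times the k-th summand of the theorem.\<close>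

definition final_term :: "nat \<Rightarrow> nat \<Rightarrow> complex" where
  "final_term t k = (-1) ^ k * q ^ ((k + 1 choose 2) + t * (k ^ 2 + k)) * (alpha_monomial q k * (1 - q ^ (2 * k + 1)))"

text \<open>Apart from the monomial, the terms at r and s differ only in the last factor, and 1 -
  q^(2s+1) = -q^(-2r-1) (1 - q^(2r+1)) supplies the coefficient in
  \<open>alpha_fold\<close>.\<close>

lemma final_term_fold:
  assumes "r + s + 1 = N"
  shows "final_term t r + final_term t s =
    (-1) ^ r * q ^ ((r + 1 choose 2) + t * (r ^ 2 + r)) * (1 - q ^ (2 * r + 1)) * alpha_fold r"
proof -
  have "q powi int (s ^ 2 + s) = q powi int (r ^ 2 + r)"
    by (rule powi_eqI[of _ _ "int s - int r"])
      (simp add: assms [symmetric] algebra_simps power2_eq_square)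
  then have "q ^ (s ^ 2 + s) = q ^ (r ^ 2 + r)"
    by (simp only: power_int_of_nat)
  then have "q ^ (t * (s ^ 2 + s)) = q ^ (t * (r ^ 2 + r))"
    by (simp only: mult.commute[of t] power_mult)
  then have "(-1) ^ s * q ^ ((s + 1 choose 2) + t * (s ^ 2 + s)) =
      (-1) ^ r * q ^ ((r + 1 choose 2) + t * (r ^ 2 + r))"
    using sign_power_choose_reflect[OF assms] by (simp only: power_add mult.assoc [symmetric])
  moreover have "1 - q ^ (2 * s + 1) = - (q powi (- 2 * int r - 1)) * (1 - q ^ (2 * r + 1))"
  proof -
    have "q powi int (2 * s + 1) = q powi (- 2 * int r - 1)"
      by (rule powi_eqI[of _ _ 2]) (simp add: assms [symmetric] algebra_simps)
    moreover have "q powi (- 2 * int r - 1) * q powi int (2 * r + 1) = 1"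
      by (simp flip: powi_add)
    ultimately show ?thesis
      by (simp only: power_int_of_nat) (simp add: right_diff_distrib del: power_Suc)
  qed
  moreover have "N - 1 - r = s"
    using assms by auto
  ultimately show ?thesis
    unfolding final_term_def alpha_fold_def by (simp only:) (simp add: algebra_simps del: power_Suc)
qed

lemma sum_final_term:
  assumes "N > 1"
  shows "(\<Sum>k<N. final_term t k) =
    (\<Sum>r<N div 2. (-1) ^ r * q ^ ((r + 1 choose 2) + t * (r ^ 2 + r)) * (1 - q ^ (2 * r + 1)) * alpha_fold r)"
proof -
  have "(\<Sum>k<N. final_term t k) = (\<Sum>k<N div 2. final_term t k) + (\<Sum>k=N div 2..<N. final_term t k)"
    by (subst sum.atLeastLessThan_concat[of 0 "N div 2" N, symmetric, unfolded atLeast0LessThan]) auto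
  \<comment> \<open>For odd N the unpaired term k = \<open>N div 2\<close> drops out, because 2k+1 =
    N makes its factor 1 - q^(2k+1) zero.\<close>
  also have "(\<Sum>k=N div 2..<N. final_term t k) = (\<Sum>k=N - N div 2..<N. final_term t k)"
  proof (cases "even N")
    case False
    then obtain M where M: "N = 2 * M + 1"
      by (blast elim: oddE)
    then have "final_term t M = 0"
      using q_power_N by (simp add: final_term_def)
    then show ?thesis
      using assms by (simp add: M sum.atLeast_Suc_lessThan)
  qed (auto elim!: evenE)
  also have "\<dots> = (\<Sum>r<N div 2. final_term t (N - 1 - r))"
    by (rule sum.reindex_bij_witness [of _ "\<lambda>r. N - 1 - r" "\<lambda>k. N - 1 - k"]) auto
  finally show ?thesis
    unfolding sum.distrib [symmetric] by (rule trans) (intro sum.cong refl final_term_fold, auto)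
qed

section \<open>Combining the Bailey expansion with the values of G_r\<close>

lemma H8_eq_sum_qsum:
  assumes "p \<ge> 1"
  shows "H8 p q = (\<Sum>r<N div 2. q ^ (p * (r ^ 2 + r)) * unit_coeff q r * qsum q (N div 2) r)"
proof -
  have "H8 p q = (\<Sum>n<N div 2. q powi (- int (n * (n + 2))) *
      (qpoch q q (2 * n + 1) * (\<Sum>r\<le>n. q ^ (p * (r ^ 2 + r)) * unit_coeff q r / (qpoch q q (n - r) * qpoch q q (n + r + 1)))))"
    unfolding H8_eq_sum_chain_sum[OF assms primitive]
  proof (rule sum.cong [OF refl])
    fix n assume "n \<in> {..<N div 2}"
    then have "2 * n + 1 < N"
      by auto
    then show "q powi (- int (n * (n + 2))) * (qpoch q q (2 * n + 1) * (chain_sum q p n / qpoch q q n)) =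
        q powi (- int (n * (n + 2))) * (qpoch q q (2 * n + 1) *
        (\<Sum>r\<le>n. q ^ (p * (r ^ 2 + r)) * unit_coeff q r / (qpoch q q (n - r) * qpoch q q (n + r + 1))))"
      by (subst chain_sum_Bailey) (simp_all add: qpoch_nonzero)
  qed
  also have "\<dots> = (\<Sum>n<N div 2. \<Sum>r\<le>n. q ^ (p * (r ^ 2 + r)) * unit_coeff q r *
      (q powi (- int (n * (n + 2))) * (qpoch q q (2 * n + 1) / (qpoch q q (n - r) * qpoch q q (n + r + 1)))))"
    unfolding sum_distrib_left by (intro sum.cong refl) (simp add: mult_ac del: of_nat_mult of_nat_add)
  also have "\<dots> = (\<Sum>r<N div 2. \<Sum>n=r..<N div 2. q ^ (p * (r ^ 2 + r)) * unit_coeff q r *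
      (q powi (- int (n * (n + 2))) * (qpoch q q (2 * n + 1) / (qpoch q q (n - r) * qpoch q q (n + r + 1)))))"
    unfolding sum.Sigma [OF finite_lessThan, OF ballI [OF finite_atMost]]
      sum.Sigma [OF finite_lessThan, OF ballI [OF finite_atLeastLessThan]]
    by (rule sum.reindex_bij_witness [of _ "\<lambda>(r, n). (n, r)" "\<lambda>(n, r). (r, n)"]) auto
  finally show ?thesis
    by (simp only: qsum_def sum_distrib_left)
qed

end

theorem theorem2p11:
  fixes p N :: nat and q :: complex
  assumes "p \<ge> 1" and "N \<ge> 1" and "primitive_root_of_unity N q"
  shows "H8 p q =
    - q * (1 - q) *
      (\<Sum>k = 0..N - 1. (-1) ^ k * q ^ ((k + 1 choose 2) + (p - 1) * (k ^ 2 + k)) * alpha q k)"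
proof -
  interpret primitive_root N q
    by unfold_locales (rule assms(3))
  show ?thesis
  proof (cases "N = 1")
    \<comment> \<open>Here q = 1: the sum over r < \<open>N div 2\<close> is empty, and the right
      side contains 1 - q = 0.\<close>
    case True
    then show ?thesis
      using H8_eq_sum_qsum[OF assms(1)] q_power_N by simp
  next
    case False
    obtain t where t: "p = Suc t"
      using assms(1) by (cases p) auto
    have "q ^ (p * (r ^ 2 + r)) * unit_coeff q r * qsum q (N div 2) r =
        - q * ((-1) ^ r * q ^ ((r + 1 choose 2) + t * (r ^ 2 + r)) * (1 - q ^ (2 * r + 1)) * alpha_fold r)"
      if "r < N div 2" for r
    proof -
      have "r + 1 choose 2 = (r choose 2) + r"
        by (simp add: numeral_2_eq_2)
      \<comment> \<open>One of the p factors q^(r^2+r) combines with q^(1-r^2) and q^(r choose 2) to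
        q times q^(r+1 choose 2); this lowers p to p-1 and produces the factor q in front of the
        sum.\<close>
      then have "int (p * (r ^ 2 + r)) + (int (r choose 2) + (1 - int r * int r)) =
          1 + int ((r + 1 choose 2) + t * (r ^ 2 + r))"
        by (simp add: t algebra_simps power2_eq_square)
      then have "q powi int (p * (r ^ 2 + r)) * (q powi int (r choose 2) * q powi (1 - int r * int r)) =
          q powi 1 * q powi int ((r + 1 choose 2) + t * (r ^ 2 + r))"
        by (simp only: powi_add [symmetric])
      then have "q ^ (p * (r ^ 2 + r)) * (q ^ (r choose 2) * q powi (1 - int r * int r)) =
          q * q ^ ((r + 1 choose 2) + t * (r ^ 2 + r))"
        by (simp only: power_int_of_nat power_int_1_right)
      then have "q ^ (p * (r ^ 2 + r)) * (q ^ (r choose 2) * q powi (1 - int r * int r)) *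
            ((-1) ^ r * (1 - q ^ (2 * r + 1)) * - alpha_fold r) =
          q * q ^ ((r + 1 choose 2) + t * (r ^ 2 + r)) * ((-1) ^ r * (1 - q ^ (2 * r + 1)) * - alpha_fold r)"
        by (simp only:)
      then show ?thesis
        unfolding qsum_eq_alpha_fold[OF that] unit_coeff_def
        by (simp only: mult_minus_left mult_minus_right mult_ac)
    qed
    then have "H8 p q = - q * (\<Sum>k<N. final_term t k)"
      using False assms(2) by (simp add: H8_eq_sum_qsum[OF assms(1)] sum_final_term sum_distrib_left)
    also have "(\<Sum>k<N. final_term t k) = (1 - q) *
        (\<Sum>k<N. (-1) ^ k * q ^ ((k + 1 choose 2) + t * (k ^ 2 + k)) * alpha q k)"
      unfolding final_term_def alpha_conv_monomial [symmetric] sum_distrib_left by (simp only: mult_ac)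
    also have "{..<N} = {0..N - 1}"
      using assms(2) by auto
    finally show ?thesis
      by (simp add: t mult.assoc)
  qed
qed

end
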